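(* Let $\Sigma$ be a signature and $E$ an inequational axiomatization over $\Sigma$. Suppose that for each inequation $t\preccurlyeq u$ (between open $\Sigma$-terms) such that $E\vdash\sigma(t)\preccurlyeq\sigma(u)$ for every closed substitution $\sigma$, there exist a mapping $R:\mathrm{T}(\Sigma)\to\mathbb{T}(\Sigma)$ and a closed substitution $\rho$ such that: (1) $E\vdash t\preccurlyeq R(\rho(t))$ and $E\vdash R(\rho(u))\preccurlyeq u$; (2) $E\vdash R(\sigma(v))\preccurlyeq R(\sigma(w))$ for each axiom $v\preccurlyeq w\in E$ and each closed substitution $\sigma$; and (3) for each function symbol $f$ of $\Sigma$ with arity $n$ and all closed terms $p_1,\dots,p_n,q_1,\dots,q_n$: $E\cup\{p_i\preccurlyeq q_i,\ R(p_i)\preccurlyeq R(q_i)\mid i=1,\dots,n\}\vdash R(f(p_1,\dots,p_n))\preccurlyeq R(f(q_1,\dots,q_n))$. Then $E$ is $\omega$-complete.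
   Context: $\mathrm{T}(\Sigma)$ and $\mathbb{T}(\Sigma)$ denote the sets of closed and open terms over $\Sigma$ (open terms may contain variables from a countably infinite set). A closed substitution maps variables to closed terms. Inequational logic: $E\vdash t\preccurlyeq u$ if derivable by reflexivity, transitivity, substitution instances of axioms, and closure under contexts ($t_i\preccurlyeq u_i$ for $i=1..n$ implies $f(t_1,..,t_n)\preccurlyeq f(u_1,..,u_n)$). $E$ is $\omega$-complete if for all terms $t,u$ with $E\vdash\sigma(t)\preccurlyeq\sigma(u)$ for all closed substitutions $\sigma$, we have $E\vdash t\preccurlyeq u$. *)

theory Defs
  imports Main "HOL-Library.FuncSet" "HOL-Library.Countable_Set"
begin

text \<open>
  A signature is a set of pairs \<open>(f, n)\<close>, read as a function symbol \<open>f\<close> of arity \<open>n\<close>;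
  \<open>(f, m)\<close> and \<open>(f, n)\<close> with \<open>m \<noteq> n\<close> are different symbols.
\<close>

type_synonym 'f signature = "('f \<times> nat) set"

datatype (vars: 'v, 'f) trm = Var 'v | Fun 'f "('v, 'f) trm list"

inductive_set terms :: "'f signature \<Rightarrow> ('v, 'f) trm set"
  for \<Sigma> :: "'f signature"
where
  Var: "Var x \<in> terms \<Sigma>"
| Fun: "(f, length ts) \<in> \<Sigma> \<Longrightarrow> (\<And>t. t \<in> set ts \<Longrightarrow> t \<in> terms \<Sigma>) \<Longrightarrow> Fun f ts \<in> terms \<Sigma>"

definition closed_terms :: "'f signature \<Rightarrow> ('v, 'f) trm set" where
  "closed_terms \<Sigma> = {t \<in> terms \<Sigma>. vars t = {}}"

primrec subst :: "('v \<Rightarrow> ('v, 'f) trm) \<Rightarrow> ('v, 'f) trm \<Rightarrow> ('v, 'f) trm" where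
  "subst \<sigma> (Var x) = \<sigma> x"
| "subst \<sigma> (Fun f ts) = Fun f (map (subst \<sigma>) ts)"

definition closed_subst :: "'f signature \<Rightarrow> ('v \<Rightarrow> ('v, 'f) trm) \<Rightarrow> bool" where
  "closed_subst \<Sigma> \<sigma> \<longleftrightarrow> (\<forall>x. \<sigma> x \<in> closed_terms \<Sigma>)"

type_synonym ('v, 'f) inequations = "(('v, 'f) trm \<times> ('v, 'f) trm) set"

text \<open>The pair \<open>(t, u)\<close> encodes the inequation \<open>t \<preceq> u\<close>.\<close>

definition inequational_axiomatization ::
    "'f signature \<Rightarrow> ('v, 'f) inequations \<Rightarrow> bool" where
  "inequational_axiomatization \<Sigma> E \<longleftrightarrow> E \<subseteq> terms \<Sigma> \<times> terms \<Sigma>"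

inductive derivable ::
    "('v, 'f) inequations \<Rightarrow> 'f signature \<Rightarrow> ('v, 'f) trm \<Rightarrow> ('v, 'f) trm \<Rightarrow> bool"
    ("(_ \<turnstile>\<^bsub>_\<^esub> _ \<preceq> _)" [51, 0, 51, 51] 50)
  for E :: "('v, 'f) inequations" and \<Sigma> :: "'f signature"
where
  refl: "t \<in> terms \<Sigma> \<Longrightarrow> E \<turnstile>\<^bsub>\<Sigma>\<^esub> t \<preceq> t"
| trans: "E \<turnstile>\<^bsub>\<Sigma>\<^esub> t \<preceq> u \<Longrightarrow> E \<turnstile>\<^bsub>\<Sigma>\<^esub> u \<preceq> v \<Longrightarrow> E \<turnstile>\<^bsub>\<Sigma>\<^esub> t \<preceq> v"
| axiom: "(t, u) \<in> E \<Longrightarrow> (\<And>x. \<sigma> x \<in> terms \<Sigma>) \<Longrightarrow> E \<turnstile>\<^bsub>\<Sigma>\<^esub> subst \<sigma> t \<preceq> subst \<sigma> u"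
| cong: "(f, n) \<in> \<Sigma> \<Longrightarrow> length ts = n \<Longrightarrow> length us = n \<Longrightarrow>
    (\<And>i. i < n \<Longrightarrow> E \<turnstile>\<^bsub>\<Sigma>\<^esub> ts ! i \<preceq> us ! i) \<Longrightarrow> E \<turnstile>\<^bsub>\<Sigma>\<^esub> Fun f ts \<preceq> Fun f us"

definition omega_complete :: "'f signature \<Rightarrow> ('v, 'f) inequations \<Rightarrow> bool" where
  "omega_complete \<Sigma> E \<longleftrightarrow>
    (\<forall>t\<in>terms \<Sigma>. \<forall>u\<in>terms \<Sigma>.
      (\<forall>\<sigma>. closed_subst \<Sigma> \<sigma> \<longrightarrow> E \<turnstile>\<^bsub>\<Sigma>\<^esub> subst \<sigma> t \<preceq> subst \<sigma> u) \<longrightarrow> E \<turnstile>\<^bsub>\<Sigma>\<^esub> t \<preceq> u)"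

end

theory Submission imports Defs begin

text \<open>
  The closed substitution \<open>\<rho>\<close> turns any derivation from \<open>E\<close> into a derivation between closed terms.
  By induction on derivations, \<open>R \<circ> \<rho>\<close> preserves derivability: (2) handles the axioms, and (3)
  handles the congruence rule, because its additional axioms are already derivable from \<open>E\<close> and can
  be cut. Applied to \<open>\<rho>(t) \<preceq> \<rho>(u)\<close>, this gives \<open>t \<preceq> R(\<rho>(t)) \<preceq> R(\<rho>(u)) \<preceq> u\<close>.
\<close>

lemma subst_in_terms:
  assumes "t \<in> terms \<Sigma>" and "\<And>x. \<sigma> x \<in> terms \<Sigma>"
  shows "subst \<sigma> t \<in> terms \<Sigma>"
  using assms(1)
proof induction
  case (Var x)
  then show ?case using assms(2) by simp
next
  case (Fun f ts)
  then show ?case by (auto intro!: terms.Fun)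
qed

lemma subst_subst: "subst \<sigma> (subst \<tau> t) = subst (\<lambda>x. subst \<sigma> (\<tau> x)) t"
  by (induction t) auto

lemma subst_eq_self_if_no_vars: "vars t = {} \<Longrightarrow> subst \<sigma> t = t"
  by (induction t) (auto intro: map_idI)

lemma vars_subst_closed: "(\<And>x. vars (\<sigma> x) = {}) \<Longrightarrow> vars (subst \<sigma> t) = {}"
  by (induction t) auto

lemma closed_subst_in_closed_terms:
  assumes "closed_subst \<Sigma> \<sigma>" and "t \<in> terms \<Sigma>"
  shows "subst \<sigma> t \<in> closed_terms \<Sigma>"
  using assms subst_in_terms[of t \<Sigma> \<sigma>] vars_subst_closed[of \<sigma> t]
  by (auto simp: closed_subst_def closed_terms_def)

text \<open>The rule \<open>axiom\<close> takes its pair from \<open>E\<close> without checking that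
  its sides are terms, so well-formedness of \<open>E\<close> has to be supplied here. The lemma
  serves to show that \<open>\<rho>\<close> makes the arguments of a congruence step closed.\<close>

lemma derivable_in_terms:
  assumes "inequational_axiomatization \<Sigma> E" and "E \<turnstile>\<^bsub>\<Sigma>\<^esub> t \<preceq> u"
  shows "t \<in> terms \<Sigma> \<and> u \<in> terms \<Sigma>"
  using assms(2)
proof induction
  case (axiom t u \<sigma>)
  then show ?case using assms(1)
    by (auto simp: inequational_axiomatization_def intro!: subst_in_terms)
next
  case (cong f n ts us)
  then show ?case by (auto intro!: terms.Fun simp: in_set_conv_nth)
qed auto

text \<open>The calculus substitutes only into axioms. Substitution into arbitrary derivations is
  admissible because an instance of an axiom instance is again an instance, under the composed
  substitution.\<close>

lemma derivable_subst:
  assumes "E \<turnstile>\<^bsub>\<Sigma>\<^esub> t \<preceq> u" and "\<And>x. \<sigma> x \<in> terms \<Sigma>"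
  shows "E \<turnstile>\<^bsub>\<Sigma>\<^esub> subst \<sigma> t \<preceq> subst \<sigma> u"
  using assms(1)
proof induction
  case (refl t)
  then show ?case using assms(2) by (intro derivable.refl subst_in_terms)
next
  case (trans t u v)
  then show ?case by (blast intro: derivable.trans)
next
  case (axiom t u \<tau>)
  then show ?case using assms(2)
    by (auto simp: subst_subst intro!: derivable.axiom subst_in_terms)
next
  case (cong f n ts us)
  then show ?case by (auto intro!: derivable.cong)
qed

text \<open>Each use of an axiom outside \<open>E\<close> is replaced by its derivation from
  \<open>E\<close>. Since axioms are used under arbitrary substitutions, that derivation must first
  be instantiated by \<open>derivable_subst\<close>.\<close>

lemma derivable_cut:
  assumes "E' \<turnstile>\<^bsub>\<Sigma>\<^esub> t \<preceq> u"
    and "\<And>v w. (v, w) \<in> E' \<Longrightarrow> (v, w) \<in> E \<or> E \<turnstile>\<^bsub>\<Sigma>\<^esub> v \<preceq> w"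
  shows "E \<turnstile>\<^bsub>\<Sigma>\<^esub> t \<preceq> u"
  using assms(1)
proof induction
  case (refl t)
  then show ?case by (rule derivable.refl)
next
  case (trans t u v)
  then show ?case by (blast intro: derivable.trans)
next
  case (axiom t u \<sigma>)
  then show ?case using assms(2) by (blast intro: derivable.axiom derivable_subst)
next
  case (cong f n ts us)
  then show ?case by (blast intro: derivable.cong)
qed

text \<open>A derivation between closed terms may pass through open terms by transitivity, where
  nothing is known about \<open>R\<close>. Putting \<open>\<rho>\<close> around both sides lets the
  induction run over arbitrary derivations while \<open>R\<close> only meets closed terms.\<close>

lemma derivable_map_closed_subst:
  assumes E: "inequational_axiomatization \<Sigma> E"
    and R: "R \<in> closed_terms \<Sigma> \<rightarrow> terms \<Sigma>"
    and \<rho>: "closed_subst \<Sigma> \<rho>"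
    and R_axiom: "\<And>v w \<sigma>. (v, w) \<in> E \<Longrightarrow> closed_subst \<Sigma> \<sigma> \<Longrightarrow>
      E \<turnstile>\<^bsub>\<Sigma>\<^esub> R (subst \<sigma> v) \<preceq> R (subst \<sigma> w)"
    and R_cong: "\<And>f n ps qs. (f, n) \<in> \<Sigma> \<Longrightarrow>
      length ps = n \<Longrightarrow> set ps \<subseteq> closed_terms \<Sigma> \<Longrightarrow>
      length qs = n \<Longrightarrow> set qs \<subseteq> closed_terms \<Sigma> \<Longrightarrow>
      (E \<union> {(ps ! i, qs ! i) | i. i < n} \<union> {(R (ps ! i), R (qs ! i)) | i. i < n})
        \<turnstile>\<^bsub>\<Sigma>\<^esub> R (Fun f ps) \<preceq> R (Fun f qs)"
    and "E \<turnstile>\<^bsub>\<Sigma>\<^esub> p \<preceq> q"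
  shows "E \<turnstile>\<^bsub>\<Sigma>\<^esub> R (subst \<rho> p) \<preceq> R (subst \<rho> q)"
  using assms(6)
proof induction
  case (refl t)
  then show ?case
    using R closed_subst_in_closed_terms[OF \<rho>] by (blast intro: derivable.refl)
next
  case (trans t u v)
  then show ?case by (blast intro: derivable.trans)
next
  case (axiom t u \<sigma>)
  \<comment> \<open>\<open>\<sigma>\<close> may produce open terms, but following it by
    \<open>\<rho>\<close> gives a closed substitution, to which \<open>R_axiom\<close>
    applies.\<close>
  have "closed_subst \<Sigma> (\<lambda>x. subst \<rho> (\<sigma> x))"
    using closed_subst_in_closed_terms[OF \<rho> axiom(2)] by (simp add: closed_subst_def)
  from R_axiom[OF axiom(1) this] show ?case by (simp add: subst_subst)
next
  case (cong f n ts us)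
  let ?ps = "map (subst \<rho>) ts" and ?qs = "map (subst \<rho>) us"
  have "set ?ps \<subseteq> closed_terms \<Sigma>" "set ?qs \<subseteq> closed_terms \<Sigma>"
    using cong derivable_in_terms[OF E] closed_subst_in_closed_terms[OF \<rho>]
    by (fastforce simp: in_set_conv_nth)+
  then have R_Fun: "(E \<union> {(?ps ! i, ?qs ! i) | i. i < n} \<union> {(R (?ps ! i), R (?qs ! i)) | i. i < n})
      \<turnstile>\<^bsub>\<Sigma>\<^esub> R (Fun f ?ps) \<preceq> R (Fun f ?qs)"
    using cong by (intro R_cong) auto
  \<comment> \<open>These are the two families of extra axioms to be cut: the first comes from the
    premises of the congruence step under \<open>\<rho>\<close>, the second from the induction
    hypotheses.\<close>
  have args: "E \<turnstile>\<^bsub>\<Sigma>\<^esub> ?ps ! i \<preceq> ?qs ! i" "E \<turnstile>\<^bsub>\<Sigma>\<^esub> R (?ps ! i) \<preceq> R (?qs ! i)" if "i < n" for i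
    using cong that \<rho>
    by (auto intro!: derivable_subst simp: closed_subst_def closed_terms_def)
  have "E \<turnstile>\<^bsub>\<Sigma>\<^esub> R (Fun f ?ps) \<preceq> R (Fun f ?qs)"
    by (rule derivable_cut[OF R_Fun]) (use args in blast)
  then show ?case by simp
qed

theorem theorem6p1:
  fixes \<Sigma> :: "'f signature" and E :: "('v, 'f) inequations"
  assumes "countable (UNIV :: 'v set)" and "infinite (UNIV :: 'v set)"
    and "inequational_axiomatization \<Sigma> E"
    and "\<And>t u. t \<in> terms \<Sigma> \<Longrightarrow> u \<in> terms \<Sigma> \<Longrightarrow>
      (\<And>\<sigma>. closed_subst \<Sigma> \<sigma> \<Longrightarrow> E \<turnstile>\<^bsub>\<Sigma>\<^esub> subst \<sigma> t \<preceq> subst \<sigma> u) \<Longrightarrow>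
      \<exists>R \<rho>. R \<in> closed_terms \<Sigma> \<rightarrow> terms \<Sigma> \<and> closed_subst \<Sigma> \<rho> \<and>
        (E \<turnstile>\<^bsub>\<Sigma>\<^esub> t \<preceq> R (subst \<rho> t) \<and> E \<turnstile>\<^bsub>\<Sigma>\<^esub> R (subst \<rho> u) \<preceq> u) \<and>
        (\<forall>(v, w)\<in>E. \<forall>\<sigma>. closed_subst \<Sigma> \<sigma> \<longrightarrow>
          E \<turnstile>\<^bsub>\<Sigma>\<^esub> R (subst \<sigma> v) \<preceq> R (subst \<sigma> w)) \<and>
        (\<forall>(f, n)\<in>\<Sigma>. \<forall>ps qs.
          length ps = n \<longrightarrow> set ps \<subseteq> closed_terms \<Sigma> \<longrightarrow>
          length qs = n \<longrightarrow> set qs \<subseteq> closed_terms \<Sigma> \<longrightarrow>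
          (E \<union> {(ps ! i, qs ! i) | i. i < n} \<union> {(R (ps ! i), R (qs ! i)) | i. i < n})
            \<turnstile>\<^bsub>\<Sigma>\<^esub> R (Fun f ps) \<preceq> R (Fun f qs))"
  shows "omega_complete \<Sigma> E"
  unfolding omega_complete_def
proof (intro ballI impI)
  fix t u :: "('v, 'f) trm"
  assume t: "t \<in> terms \<Sigma>" and u: "u \<in> terms \<Sigma>"
    and inst: "\<forall>\<sigma>. closed_subst \<Sigma> \<sigma> \<longrightarrow> E \<turnstile>\<^bsub>\<Sigma>\<^esub> subst \<sigma> t \<preceq> subst \<sigma> u"
  obtain R \<rho> where R: "R \<in> closed_terms \<Sigma> \<rightarrow> terms \<Sigma>" and \<rho>: "closed_subst \<Sigma> \<rho>"
    and tR: "E \<turnstile>\<^bsub>\<Sigma>\<^esub> t \<preceq> R (subst \<rho> t)" and Ru: "E \<turnstile>\<^bsub>\<Sigma>\<^esub> R (subst \<rho> u) \<preceq> u"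
    and R_axiom: "\<forall>(v, w)\<in>E. \<forall>\<sigma>. closed_subst \<Sigma> \<sigma> \<longrightarrow>
      E \<turnstile>\<^bsub>\<Sigma>\<^esub> R (subst \<sigma> v) \<preceq> R (subst \<sigma> w)"
    and R_cong: "\<forall>(f, n)\<in>\<Sigma>. \<forall>ps qs.
      length ps = n \<longrightarrow> set ps \<subseteq> closed_terms \<Sigma> \<longrightarrow>
      length qs = n \<longrightarrow> set qs \<subseteq> closed_terms \<Sigma> \<longrightarrow>
      (E \<union> {(ps ! i, qs ! i) | i. i < n} \<union> {(R (ps ! i), R (qs ! i)) | i. i < n})
        \<turnstile>\<^bsub>\<Sigma>\<^esub> R (Fun f ps) \<preceq> R (Fun f qs)"
    by (rule exE[OF assms(4)[OF t u]]) (use inst in blast, elim exE conjE, rule that)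
  \<comment> \<open>Only closed instances of the inequation are known to be derivable, so the lemma
    is applied to the instance under \<open>\<rho>\<close>. The second \<open>\<rho>\<close> that it
    adds is harmless, since closed terms are fixed by every substitution.\<close>
  have "E \<turnstile>\<^bsub>\<Sigma>\<^esub> R (subst \<rho> (subst \<rho> t)) \<preceq> R (subst \<rho> (subst \<rho> u))"
  proof (rule derivable_map_closed_subst[OF assms(3) R \<rho>])
    show "E \<turnstile>\<^bsub>\<Sigma>\<^esub> subst \<rho> t \<preceq> subst \<rho> u" using inst \<rho> by blast
  next
    show "E \<turnstile>\<^bsub>\<Sigma>\<^esub> R (subst \<sigma> v) \<preceq> R (subst \<sigma> w)"
      if "(v, w) \<in> E" and "closed_subst \<Sigma> \<sigma>" for v w \<sigma>
      using bspec[OF R_axiom that(1)] that(2) by simp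
  qed (drule bspec[OF R_cong], simp)
  moreover have "subst \<rho> (subst \<rho> s) = subst \<rho> s" if "s \<in> terms \<Sigma>" for s
    using closed_subst_in_closed_terms[OF \<rho> that]
    by (simp add: closed_terms_def subst_eq_self_if_no_vars)
  ultimately have "E \<turnstile>\<^bsub>\<Sigma>\<^esub> R (subst \<rho> t) \<preceq> R (subst \<rho> u)"
    using t u by simp
  then show "E \<turnstile>\<^bsub>\<Sigma>\<^esub> t \<preceq> u"
    using tR Ru by (blast intro: derivable.trans)
qed

end
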